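(* Let $G_{CP}$ be the $3$-uniform hypergraph on the $15$-element vertex set $X \cup Y \cup Z$, where $X = \{x_1, x_2, x_3\}$, $Y = \{y_1, \ldots, y_6\}$ and $Z = \{z_1, \ldots, z_6\}$, whose edge set consists of - $e_i = \{y_{2i-1}, y_{2i}, x_{i+1}\}$ for $i \in \{1,2,3\}$, where $x_4 = x_1$, - $f_i = \{x_{\lceil i/2 \rceil}, y_i, z_i\}$ for $i \in \{1, \ldots, 6\}$, and - $g = \{x_1, x_2, x_3\}$. Then Chooser wins (i.e. has a winning strategy for) the Chooser-Picker game on $G_{CP}$.
   Context: The Chooser-Picker game on a finite hypergraph $G$ is the following two-player perfect-information game. On each turn, Picker selects a pair $\{x, y\}$ of (distinct) unclaimed vertices of $G$ to offer to Chooser. Chooser claims one of the two offered vertices, and Picker then claims the other one. If a position is reached in which only one unclaimed vertex remains, Chooser automatically claims that final vertex. Chooser wins if he claims every vertex of some edge of $G$; otherwise Picker wins. A player "wins" the game on $G$ if that player has a winning strategy. *)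

theory Defs
  imports Main
begin

text \<open>A hypergraph is given by its vertex set and its set of edges.\<close>

type_synonym 'a hypergraph = "'a set \<times> 'a set set"

definition finite_hypergraph :: "'a hypergraph \<Rightarrow> bool" where
  "finite_hypergraph G \<longleftrightarrow> finite (fst G) \<and> (\<forall>e\<in>snd G. e \<subseteq> fst G)"

definition uniform :: "nat \<Rightarrow> 'a hypergraph \<Rightarrow> bool" where
  "uniform k G \<longleftrightarrow> (\<forall>e\<in>snd G. card e = k)"

text \<open>
  A history lists the completed turns in order. The entry \<open>(c, p)\<close> says that Picker offered
  \<open>{c, p}\<close>, that Chooser claimed \<open>c\<close> and that Picker claimed \<open>p\<close>.
\<close>

type_synonym 'a history = "('a \<times> 'a) list"

definition unclaimed :: "'a hypergraph \<Rightarrow> 'a history \<Rightarrow> 'a set" where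
  "unclaimed G h = fst G - (fst ` set h \<union> snd ` set h)"

definition offers :: "'a hypergraph \<Rightarrow> 'a history \<Rightarrow> 'a set set" where
  "offers G h = {P. P \<subseteq> unclaimed G h \<and> card P = 2}"

text \<open>A strategy of Chooser answers the pair offered after a given history.\<close>

type_synonym 'a strategy = "'a history \<Rightarrow> 'a set \<Rightarrow> 'a"

definition chooser_strategy :: "'a hypergraph \<Rightarrow> 'a strategy \<Rightarrow> bool" where
  "chooser_strategy G \<sigma> \<longleftrightarrow> (\<forall>h. \<forall>P\<in>offers G h. \<sigma> h P \<in> P)"

text \<open>
  The histories that can arise when Chooser follows \<open>\<sigma>\<close> and Picker makes arbitrary legal offers.
\<close>

inductive play :: "'a hypergraph \<Rightarrow> 'a strategy \<Rightarrow> 'a history \<Rightarrow> bool"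
  for G :: "'a hypergraph" and \<sigma> :: "'a strategy" where
  start: "play G \<sigma> []"
| turn: "\<lbrakk>play G \<sigma> h; {c, p} \<in> offers G h; \<sigma> h {c, p} = c\<rbrakk> \<Longrightarrow> play G \<sigma> (h @ [(c, p)])"

text \<open>
  No further pair can be offered once at most one vertex is unclaimed (the hypergraph being finite).
\<close>

definition game_over :: "'a hypergraph \<Rightarrow> 'a history \<Rightarrow> bool" where
  "game_over G h \<longleftrightarrow> card (unclaimed G h) \<le> 1"

text \<open>
  The vertices that Chooser owns at the end of the game: when a single vertex remains unclaimed,
  it goes to him automatically. Meaningful only for histories at which the game is over.
\<close>

definition chooser_final :: "'a hypergraph \<Rightarrow> 'a history \<Rightarrow> 'a set" where
  "chooser_final G h = fst ` set h \<union> unclaimed G h"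

definition chooser_winning_strategy :: "'a hypergraph \<Rightarrow> 'a strategy \<Rightarrow> bool" where
  "chooser_winning_strategy G \<sigma> \<longleftrightarrow>
     chooser_strategy G \<sigma> \<and>
     (\<forall>h. play G \<sigma> h \<and> game_over G h \<longrightarrow> (\<exists>e\<in>snd G. e \<subseteq> chooser_final G h))"

definition chooser_wins :: "'a hypergraph \<Rightarrow> bool" where
  "chooser_wins G \<longleftrightarrow> (\<exists>\<sigma>. chooser_winning_strategy G \<sigma>)"

datatype vertex = X nat | Y nat | Z nat

definition V_CP :: "vertex set" where
  "V_CP = X ` {1..3} \<union> Y ` {1..6} \<union> Z ` {1..6}"

definition e_CP :: "nat \<Rightarrow> vertex set" where
  "e_CP i = {Y (2 * i - 1), Y (2 * i), X (if i = 3 then 1 else i + 1)}"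

text \<open>For a natural number \<open>i\<close>, the ceiling of \<open>i / 2\<close> is \<open>(i + 1) div 2\<close>.\<close>

definition f_CP :: "nat \<Rightarrow> vertex set" where
  "f_CP i = {X ((i + 1) div 2), Y i, Z i}"

definition g_CP :: "vertex set" where
  "g_CP = {X 1, X 2, X 3}"

definition G_CP :: "vertex hypergraph" where
  "G_CP = (V_CP, e_CP ` {1..3} \<union> f_CP ` {1..6} \<union> {g_CP})"

lemma card_V_CP: "card V_CP = 15"
proof -
  have "card (X ` {1..3}) = 3" "card (Y ` {1..6}) = 6" "card (Z ` {1..6}) = 6"
    by (simp_all add: card_image inj_on_def)
  moreover have "X ` {1..3} \<inter> Y ` {1..6} = {}" "(X ` {1..3} \<union> Y ` {1..6}) \<inter> Z ` {1..6} = {}"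
    by auto
  ultimately show ?thesis
    unfolding V_CP_def by (simp add: card_Un_disjoint)
qed

lemma edges_G_CP:
  "snd G_CP =
    {{Y 1, Y 2, X 2}, {Y 3, Y 4, X 3}, {Y 5, Y 6, X 1},
     {X 1, Y 1, Z 1}, {X 1, Y 2, Z 2}, {X 2, Y 3, Z 3},
     {X 2, Y 4, Z 4}, {X 3, Y 5, Z 5}, {X 3, Y 6, Z 6},
     {X 1, X 2, X 3}}"
proof -
  have "{1..3} = {1, 2, 3 :: nat}" "{1..6} = {1, 2, 3, 4, 5, 6 :: nat}"
    by auto
  then show ?thesis
    by (simp add: G_CP_def e_CP_def f_CP_def g_CP_def insert_commute flip: numeral_2_eq_2)
qed

lemma finite_hypergraph_G_CP: "finite_hypergraph G_CP"
  unfolding finite_hypergraph_def edges_G_CP by (auto simp: G_CP_def V_CP_def)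

lemma uniform_G_CP: "uniform 3 G_CP"
  unfolding uniform_def edges_G_CP by simp

end

theory Submission
  imports Defs
begin

text \<open>
  If an edge consists of vertices of Chooser and two unclaimed vertices \<open>a\<close>, \<open>b\<close>, Picker has to offer
  exactly \<open>{a, b}\<close> at some point: an offer containing only one of them lets Chooser take it and
  later the other one. So Chooser may decide in advance who gets which of \<open>a\<close>, \<open>b\<close> and play as if
  that turn had already taken place. On \<open>G_CP\<close>, whatever Picker offers in the first turn, one of
  the two possible answers starts a chain of such threats that ends with a completed edge.
\<close>

text \<open>Positional form of the game: \<open>C\<close> holds Chooser's vertices and
  \<open>U\<close> the unclaimed ones. The order of turns is forgotten, so that real and imagined
  turns can be exchanged.\<close>

inductive secures :: "'a set set \<Rightarrow> 'a set \<Rightarrow> 'a set \<Rightarrow> bool" for E :: "'a set set" where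
  final: "\<lbrakk>finite U; card U \<le> 1; e \<in> E; e \<subseteq> C \<union> U\<rbrakk> \<Longrightarrow> secures E C U"
| offer: "\<lbrakk>finite U; 1 < card U;
     \<And>a b. \<lbrakk>a \<in> U; b \<in> U; a \<noteq> b\<rbrakk> \<Longrightarrow>
       secures E (insert a C) (U - {a, b}) \<or> secures E (insert b C) (U - {a, b})\<rbrakk>
     \<Longrightarrow> secures E C U"

lemma secures_final:
  assumes "secures E C U" "card U \<le> 1"
  obtains e where "e \<in> E" "e \<subseteq> C \<union> U"
  using assms by (auto elim: secures.cases)

lemma secures_offer:
  assumes "secures E C U" "a \<in> U" "b \<in> U" "a \<noteq> b"
  shows "secures E (insert a C) (U - {a, b}) \<or> secures E (insert b C) (U - {a, b})"
  using assms(1)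
proof cases
  \<comment> \<open>Impossible here, since \<open>U\<close> contains two distinct vertices.\<close>
  case (final e)
  have "card {a, b} \<le> card U"
    using assms \<open>finite U\<close> by (intro card_mono) auto
  then show ?thesis
    using final assms by simp
next
  case offer
  then show ?thesis
    using assms by blast
qed

lemma chooser_wins_if_secures:
  assumes "secures (snd G) {} (fst G)"
  shows "chooser_wins G"
proof -
  define good where
    "good h P x \<longleftrightarrow> x \<in> P \<and> secures (snd G) (insert x (fst ` set h)) (unclaimed G h - P)" for h P x
  \<comment> \<open>The default only keeps the answer legal; along plays that follow
    \<open>\<sigma>\<close>, every legal offer has a good answer.\<close>
  define \<sigma> where
    "\<sigma> h P = (if \<exists>x. good h P x then SOME x. good h P x else SOME x. x \<in> P)" for h P
  have good: "good h P (\<sigma> h P)" if "good h P x" for h P x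
    unfolding \<sigma>_def using that someI[of "good h P"] by auto
  have "\<sigma> h P \<in> P" if "P \<in> offers G h" for h P
  proof (cases "\<exists>x. good h P x")
    case True
    then show ?thesis
      using good unfolding good_def by blast
  next
    case False
    have "P \<noteq> {}"
      using that by (auto simp: offers_def)
    then show ?thesis
      using False some_in_eq[of P] by (simp add: \<sigma>_def)
  qed
  then have "chooser_strategy G \<sigma>"
    by (simp add: chooser_strategy_def)
  moreover have "secures (snd G) (fst ` set h) (unclaimed G h)" if "play G \<sigma> h" for h
    using that
  proof induction
    case start
    then show ?case
      using assms by (simp add: unclaimed_def)
  next
    case (turn h c p)
    from turn.hyps(2) have "c \<in> unclaimed G h" "p \<in> unclaimed G h" "c \<noteq> p"
      by (auto simp: offers_def card_2_iff doubleton_eq_iff)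
    then have "\<exists>x. good h {c, p} x"
      using secures_offer[OF turn.IH, of c p] by (auto simp: good_def)
    then have "good h {c, p} c"
      using good turn.hyps(3) by metis
    moreover have "unclaimed G (h @ [(c, p)]) = unclaimed G h - {c, p}"
      by (auto simp: unclaimed_def)
    ultimately show ?case
      by (simp add: good_def)
  qed
  then have "\<exists>e\<in>snd G. e \<subseteq> chooser_final G h" if "play G \<sigma> h" "game_over G h" for h
    using that unfolding game_over_def chooser_final_def by (metis secures_final)
  ultimately show ?thesis
    unfolding chooser_wins_def chooser_winning_strategy_def by blast
qed

text \<open>Chooser takes \<open>v\<close> when it is offered and answers arbitrarily otherwise; if
  \<open>v\<close> is never offered, it is the last vertex and falls to him. Allowing
  \<open>v \<in> C\<close> keeps the hypothesis stable after \<open>v\<close> is claimed.\<close>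

lemma secures_single_threat:
  assumes "finite U" "e \<in> E" "e \<subseteq> insert v C" "v \<in> C \<union> U"
  shows "secures E C U"
  using assms(1,3,4)
proof (induction U arbitrary: C rule: finite_psubset_induct)
  case (psubset U)
  show ?case
  proof (cases "card U \<le> 1")
    case True
    then show ?thesis
      using psubset.prems psubset.hyps assms(2) by (intro final[of U e]) auto
  next
    case False
    have "secures E (insert x C) (U - {a, b})"
      if "a \<in> U" "x = v \<or> v \<notin> {a, b}" for a b x
      using that psubset.prems by (intro psubset.IH) auto
    then have "secures E (insert a C) (U - {a, b}) \<or> secures E (insert b C) (U - {a, b})"
      if "a \<in> U" "b \<in> U" for a b
      using that by (cases "v = b") blast+
    then show ?thesis
      using False psubset.hyps by (intro offer) simp_all
  qed
qed

lemma secures_double_threat: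
  assumes "finite U" "e \<in> E" "e \<subseteq> insert a (insert b C)" "a \<in> U" "b \<in> U" "a \<noteq> b"
    and "secures E (insert a C) (U - {a, b})"
  shows "secures E C U"
  using assms(1,3-)
proof (induction U arbitrary: C rule: finite_psubset_induct)
  case (psubset U)
  \<comment> \<open>Chooser takes one vertex of the pair while the other stays unclaimed as a single
    threat.\<close>
  have single: "secures E (insert x C) (U - {p, q})"
    if "{x, y} = {a, b}" "y \<notin> {p, q}" for x y p q
    using that psubset.prems psubset.hyps
    by (intro secures_single_threat[OF _ assms(2), of _ y]) (auto simp: doubleton_eq_iff)
  have step: "secures E (insert p C) (U - {p, q}) \<or> secures E (insert q C) (U - {p, q})"
    if "p \<in> U" "q \<in> U" "p \<noteq> q" for p q
  proof (cases "{p, q} \<inter> {a, b} = {}")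
    \<comment> \<open>The real turn on \<open>{p, q}\<close> commutes with the imagined one on
      \<open>{a, b}\<close>: the answer that works after the imagined turn is used now.\<close>
    case True
    have "secures E (insert x C) (U - {p, q})"
      if "secures E (insert x (insert a C)) (U - {a, b} - {p, q})" for x
    proof (rule psubset.IH)
      show "secures E (insert a (insert x C)) (U - {p, q} - {a, b})"
        using that by (simp add: insert_commute Diff_eq Int_ac)
    qed (use psubset.prems True \<open>p \<in> U\<close> in auto)
    then show ?thesis
      using secures_offer[OF psubset.prems(5), of p q] that True by auto
  next
    case False
    then consider "{p, q} = {a, b}" | "a \<in> {p, q}" "b \<notin> {p, q}" | "b \<in> {p, q}" "a \<notin> {p, q}"
      using \<open>p \<noteq> q\<close> psubset.prems(4) by (auto simp: insert_commute)
    then show ?thesis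
    proof cases
      case 1
      \<comment> \<open>The imagined turn becomes real.\<close>
      then show ?thesis
        using psubset.prems(5) by (auto simp: doubleton_eq_iff insert_commute)
    next
      case 2
      then show ?thesis
        using single[of a b p q] by auto
    next
      case 3
      then show ?thesis
        using single[of b a p q] by (auto simp: insert_commute)
    qed
  qed
  have "card {a, b} \<le> card U"
    using psubset.prems psubset.hyps by (intro card_mono) auto
  then show ?case
    using step psubset.hyps psubset.prems(4) by (intro offer) simp_all
qed

text \<open>
  The entry \<open>(a, b)\<close> of \<open>ps\<close> is a threat on \<open>{a, b}\<close> that Chooser resolves by claiming \<open>a\<close>;
  in the end \<open>s\<close> completes an edge.
\<close>

fun threats :: "'a set set \<Rightarrow> 'a set \<Rightarrow> ('a \<times> 'a) list \<Rightarrow> 'a \<Rightarrow> bool" where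
  "threats E C [] s \<longleftrightarrow> (\<exists>e\<in>E. e \<subseteq> insert s C)"
| "threats E C ((a, b) # ps) s \<longleftrightarrow>
     (\<exists>e\<in>E. e \<subseteq> insert a (insert b C)) \<and> threats E (insert a C) ps s"

fun threat_vertices :: "('a \<times> 'a) list \<Rightarrow> 'a \<Rightarrow> 'a list" where
  "threat_vertices [] s = [s]"
| "threat_vertices ((a, b) # ps) s = a # b # threat_vertices ps s"

text \<open>Each entry is one double threat, and \<open>s\<close> is the closing single threat.
  Distinctness keeps later threats untouched when a pair is resolved.\<close>

lemma secures_if_threats:
  assumes "threats E C ps s" "distinct (threat_vertices ps s)" "set (threat_vertices ps s) \<subseteq> U"
    and "finite U"
  shows "secures E C U"
  using assms
proof (induction E C ps s arbitrary: U rule: threats.induct)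
  case (1 E C s)
  then show ?case
    by (auto intro: secures_single_threat)
next
  case (2 E C a b ps s)
  from "2.prems"(1) obtain e where e: "e \<in> E" "e \<subseteq> insert a (insert b C)"
    by auto
  have "secures E (insert a C) (U - {a, b})"
    using "2.prems" by (intro "2.IH") auto
  then show ?case
    using "2.prems" by (intro secures_double_threat[OF _ e]) auto
qed

text \<open>
  The entry \<open>(c, ps, s)\<close> answers every first offer \<open>{c, p}\<close> whose other vertex \<open>p\<close> does not
  occur in \<open>ps\<close> or \<open>s\<close>. The list was found by a computer search.
\<close>

definition openings :: "(vertex \<times> (vertex \<times> vertex) list \<times> vertex) list" where
  "openings =
    [(X 1, [(Y 6, Y 5), (X 3, Z 6)], X 2),
     (X 1, [(Y 1, Z 1), (Y 2, X 2)], Z 2),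
     (X 2, [(Y 2, Y 1), (X 1, Z 2)], X 3),
     (X 2, [(Y 3, Z 3), (Y 4, X 3)], Z 4),
     (X 3, [(Y 3, Y 4), (X 2, Z 3)], X 1),
     (X 3, [(Y 5, Z 5), (Y 6, X 1)], Z 6),
     (Y 1, [(X 2, Y 2), (X 1, Z 1)], X 3),
     (Y 1, [(X 2, Y 2), (Y 4, Z 4), (X 3, Y 3)], X 1),
     (Y 2, [(X 2, Y 1), (X 3, X 1), (Z 5, Y 5), (Y 3, Y 4)], Z 3),
     (Y 2, [(X 1, Z 2), (Y 6, Y 5), (X 3, Z 6)], X 2),
     (Y 3, [(X 3, Y 4), (Y 5, Z 5), (X 1, Y 6)], X 2),
     (Y 4, [(X 3, Y 3), (X 1, X 2), (Z 1, Y 1), (Z 2, Y 2), (Y 5, Y 6)], Z 5),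
     (Y 4, [(X 2, Z 4), (X 1, X 3), (Y 5, Y 6), (Y 1, Y 2)], Z 1),
     (Y 5, [(X 1, Y 6), (Y 1, Z 1), (X 2, Y 2)], X 3),
     (Y 5, [(X 3, Z 5), (Y 4, Y 3), (X 2, Z 4)], X 1),
     (Y 6, [(X 3, Z 6), (Y 3, Y 4), (X 1, Y 5)], X 2),
     (Y 6, [(X 1, Y 5), (Y 2, Z 2), (X 2, Y 1)], X 3),
     (Z 1, [(X 1, Y 1), (Y 6, Y 5), (X 3, Z 6)], X 2),
     (Z 2, [(X 1, Y 2), (Y 6, Y 5), (Z 1, Y 1), (X 3, Z 6)], X 2),
     (Z 3, [(X 2, Y 3), (X 1, X 3), (Y 5, Y 6), (Y 1, Y 2)], Z 1),
     (Z 5, [(Y 5, X 3), (X 1, Y 6), (Y 1, Z 1), (Y 2, X 2)], Z 2),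
     (Z 6, [(X 3, Y 6), (Y 3, Y 4), (X 2, Z 3)], X 1)]"

lemma V_CP_eq:
  "V_CP = {X 1, X 2, X 3, Y 1, Y 2, Y 3, Y 4, Y 5, Y 6, Z 1, Z 2, Z 3, Z 4, Z 5, Z 6}"
proof -
  have "{1..3} = {1, 2, 3 :: nat}" "{1..6} = {1, 2, 3, 4, 5, 6 :: nat}"
    by auto
  then show ?thesis
    unfolding V_CP_def by auto
qed

lemma openings_threats:
  "\<forall>(c, ps, s)\<in>set openings. threats (snd G_CP) {c} ps s \<and> distinct (threat_vertices ps s)"
  unfolding openings_def edges_G_CP by code_simp

text \<open>A finite check over all first offers. Since \<open>c\<close> is itself offered, avoiding
  \<open>{a, b}\<close> also keeps \<open>c\<close> out of the threats. No entry starts with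
  \<open>Z 4\<close>, so Chooser always refuses it in the first turn.\<close>

lemma openings_answer_all_offers:
  "\<forall>a\<in>V_CP. \<forall>b\<in>V_CP. a \<noteq> b \<longrightarrow>
     (\<exists>(c, ps, s)\<in>set openings. c \<in> {a, b} \<and> set (threat_vertices ps s) \<subseteq> V_CP - {a, b})"
  unfolding openings_def V_CP_eq by code_simp

theorem proposition7: "chooser_wins G_CP"
proof (rule chooser_wins_if_secures, rule offer)
  show "finite (fst G_CP)" "1 < card (fst G_CP)"
    using finite_hypergraph_G_CP card_V_CP by (simp_all add: finite_hypergraph_def G_CP_def)
next
  fix a b
  assume ab: "a \<in> fst G_CP" "b \<in> fst G_CP" "a \<noteq> b"
  then obtain c ps s where line: "(c, ps, s) \<in> set openings" "c \<in> {a, b}"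
    "set (threat_vertices ps s) \<subseteq> fst G_CP - {a, b}"
    using openings_answer_all_offers unfolding G_CP_def by fastforce
  then have "threats (snd G_CP) {c} ps s" "distinct (threat_vertices ps s)"
    using openings_threats by auto
  then have "secures (snd G_CP) {c} (fst G_CP - {a, b})"
    using line(3) finite_hypergraph_G_CP
    by (intro secures_if_threats) (auto simp: finite_hypergraph_def)
  then show "secures (snd G_CP) {a} (fst G_CP - {a, b}) \<or>
      secures (snd G_CP) {b} (fst G_CP - {a, b})"
    using line(2) by auto
qed

end
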